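(* Let $\mu$ be a nontrivial positive measure on $\mathbb T$, let $m\ge1$, and let $p_j(z)=z^{\lfloor j/2\rfloor}$, $j=0,1,\dots,2m$. Let $w\in\mathbb C$ be such that $$K_k(0,w;\mu)\ne0\quad\text{and}\quad \deg K_k(\cdot,w;\mu)=k\qquad\text{for all }k\in\mathbb N .$$ Then, for every $n\ge0$, the polynomials $Q_0(\cdot,w),Q_1(\cdot,w),\dots,Q_{2m}(\cdot,w)$, where $Q_j(z,w):=p_j(z)\,K_{n+2m-j}(z,w;\mu)$, are linearly independent. In particular, this holds for every $w$ with $|w|=1$.
   Context: $\mathbb T=\{\zeta\in\mathbb C:|\zeta|=1\}$; nontrivial means with infinite support, and $\mu$ is a finite Borel measure. $\varphi_k(z;\mu)$, $k\ge0$, are the orthonormal polynomials with respect to $\mu$ ($\deg\varphi_k=k$, positive leading coefficient), and $K_n(z,w;\mu)=\sum_{k=0}^n\overline{\varphi_k(w;\mu)}\,\varphi_k(z;\mu)$, $n\ge0$, are the Christoffel-Darboux kernels. *)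

theory Defs
  imports "HOL-Analysis.Analysis" "HOL-Computational_Algebra.Polynomial"
begin

definition measure_support :: "'a::topological_space measure \<Rightarrow> 'a set" where
  "measure_support M = {x \<in> space M. \<forall>U. open U \<longrightarrow> x \<in> U \<longrightarrow> emeasure M (U \<inter> space M) > 0}"

text \<open>The underlying space of the measure is the unit circle itself, not the complex plane.\<close>

definition nontrivial_circle_measure :: "complex measure \<Rightarrow> bool" where
  "nontrivial_circle_measure M \<longleftrightarrow>
     sets M = sets (restrict_space borel (sphere 0 1)) \<and> finite_measure M \<and>
     infinite (measure_support M)"

definition L2_inner :: "complex measure \<Rightarrow> complex poly \<Rightarrow> complex poly \<Rightarrow> complex" where
  "L2_inner M p q = (LINT z|M. poly p z * cnj (poly q z))"

definition is_orthonormal_polys :: "complex measure \<Rightarrow> (nat \<Rightarrow> complex poly) \<Rightarrow> bool" where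
  "is_orthonormal_polys M \<phi> \<longleftrightarrow>
     (\<forall>k. degree (\<phi> k) = k \<and> lead_coeff (\<phi> k) \<in> \<real> \<and> Re (lead_coeff (\<phi> k)) > 0) \<and>
     (\<forall>j k. L2_inner M (\<phi> j) (\<phi> k) = (if j = k then 1 else 0))"

text \<open>Well defined for every nontrivial measure on the circle: see
  \<open>ex1_orthonormal_polys\<close> below.\<close>

definition orthonormal_poly :: "complex measure \<Rightarrow> nat \<Rightarrow> complex poly" where
  "orthonormal_poly M = (THE \<phi>. is_orthonormal_polys M \<phi>)"

text \<open>\<open>CD_kernel M n w\<close> is the polynomial \<open>K\<^sub>n(\<cdot>, w; M)\<close>; its value at \<open>z\<close> is
  \<open>poly (CD_kernel M n w) z\<close>.\<close>

definition CD_kernel :: "complex measure \<Rightarrow> nat \<Rightarrow> complex \<Rightarrow> complex poly" where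
  "CD_kernel M n w =
     (\<Sum>k\<le>n. smult (cnj (poly (orthonormal_poly M k) w)) (orthonormal_poly M k))"

text \<open>Linear independence over \<open>\<complex>\<close> of a finite or infinite family of polynomials. The library
  notion concerns sets, so repetitions within the family are excluded separately.\<close>

definition lin_indep_family :: "(nat \<Rightarrow> complex poly) \<Rightarrow> nat set \<Rightarrow> bool" where
  "lin_indep_family Q J \<longleftrightarrow> inj_on Q J \<and> \<not> module.dependent smult (Q ` J)"


subsection \<open>Existence and uniqueness of the orthonormal polynomials\<close>

context
  fixes M :: "complex measure"
  assumes M: "nontrivial_circle_measure M"
begin

lemma space_circle: "space M = sphere 0 1"
proof -
  have "space M = space (restrict_space borel (sphere (0::complex) 1))"
    using M by (intro sets_eq_imp_space_eq) (simp add: nontrivial_circle_measure_def)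
  then show ?thesis by (simp add: space_restrict_space)
qed

lemma integrable_circle:
  fixes f :: "complex \<Rightarrow> complex"
  assumes "continuous_on UNIV f"
  shows "integrable M f"
proof -
  interpret finite_measure M using M by (simp add: nontrivial_circle_measure_def)
  have "f \<in> borel_measurable borel"
    using assms by (rule borel_measurable_continuous_onI)
  then have "f \<in> borel_measurable (restrict_space borel (sphere 0 1))"
    by (rule measurable_restrict_space1)
  then have meas: "f \<in> borel_measurable M"
    using M measurable_cong_sets[of M "restrict_space borel (sphere 0 1)" "borel :: complex measure" borel]
    by (simp add: nontrivial_circle_measure_def)
  have "compact (f ` sphere 0 1)"
    using assms by (intro compact_continuous_image continuous_on_subset[OF assms]) auto
  then obtain B where "\<And>z. z \<in> sphere 0 1 \<Longrightarrow> norm (f z) \<le> B"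
    by (meson bounded_iff compact_imp_bounded image_eqI)
  then show ?thesis
    using meas by (intro integrable_const_bound[of _ B]) (auto simp: space_circle)
qed

lemma integrable_prod: "integrable M (\<lambda>z. poly p z * cnj (poly q z))"
  by (intro integrable_circle continuous_intros)

lemma L2_inner_add: "L2_inner M (p + q) r = L2_inner M p r + L2_inner M q r"
  unfolding L2_inner_def by (simp add: distrib_right integrable_prod)

lemma L2_inner_smult: "L2_inner M (smult c p) r = c * L2_inner M p r"
  unfolding L2_inner_def by (simp add: mult.assoc)

lemma L2_inner_diff: "L2_inner M (p - q) r = L2_inner M p r - L2_inner M q r"
  unfolding L2_inner_def by (simp add: left_diff_distrib integrable_prod)

lemma L2_inner_0: "L2_inner M 0 r = 0"
  unfolding L2_inner_def by simp

lemma L2_inner_sum: "L2_inner M (sum f A) r = (\<Sum>i\<in>A. L2_inner M (f i) r)"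
  by (induction A rule: infinite_finite_induct) (auto simp: L2_inner_0 L2_inner_add)

lemma L2_inner_commute: "L2_inner M q p = cnj (L2_inner M p q)"
proof -
  have "cnj (L2_inner M p q) = (LINT z|M. cnj (poly p z * cnj (poly q z)))"
    unfolding L2_inner_def by (rule Bochner_Integration.integral_cnj[symmetric])
  then show ?thesis unfolding L2_inner_def by (simp add: mult.commute)
qed

lemma L2_inner_self: "L2_inner M p p = of_real (LINT z|M. (cmod (poly p z))\<^sup>2)"
  unfolding L2_inner_def integral_complex_of_real[symmetric]
  by (intro Bochner_Integration.integral_cong) (simp_all only: complex_norm_square[symmetric])

lemma L2_inner_pos:
  assumes "p \<noteq> 0"
  shows "(LINT z|M. (cmod (poly p z))\<^sup>2) > 0"
proof (rule ccontr)
  assume neg: "\<not> ?thesis"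
  have int: "integrable M (\<lambda>z. (cmod (poly p z))\<^sup>2)"
  proof -
    have "integrable M (\<lambda>z. Re (poly p z * cnj (poly p z)))"
      by (intro integrable_Re integrable_prod)
    then show ?thesis by (simp add: complex_mult_cnj cmod_def)
  qed
  have "(LINT z|M. (cmod (poly p z))\<^sup>2) = 0"
  proof (rule antisym)
    show "(LINT z|M. (cmod (poly p z))\<^sup>2) \<le> 0" using neg by linarith
    show "0 \<le> (LINT z|M. (cmod (poly p z))\<^sup>2)"
      by (rule Bochner_Integration.integral_nonneg) simp
  qed
  then have AE0: "AE z in M. poly p z = 0"
    using integral_nonneg_eq_0_iff_AE[OF int] by simp
  have "finite {z. poly p z = 0}"
    using assms by (rule poly_roots_finite)
  then obtain x where x: "x \<in> measure_support M" "poly p x \<noteq> 0"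
    using M unfolding nontrivial_circle_measure_def
    by (metis (mono_tags, lifting) finite_subset mem_Collect_eq subsetI)
  define U where "U = {z. poly p z \<noteq> 0}"
  have "open U" unfolding U_def
    by (intro open_Collect_neq continuous_intros)
  then have pos: "emeasure M (U \<inter> space M) > 0"
    using x unfolding measure_support_def U_def by blast
  have "U \<inter> space M \<in> sets M"
  proof -
    have "U \<inter> sphere 0 1 \<in> sets (restrict_space borel (sphere (0::complex) 1))"
      using \<open>open U\<close> by (auto simp: sets_restrict_space)
    then show ?thesis
      using M unfolding space_circle nontrivial_circle_measure_def by blast
  qed
  moreover have "{z \<in> space M. \<not> poly p z = 0} = U \<inter> space M"
    unfolding U_def by blast
  ultimately have "emeasure M (U \<inter> space M) = 0"
    using AE0 by (simp add: AE_iff_measurable)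
  then show False using pos by simp
qed

lemma orthogonal_lower_degree:
  assumes \<phi>: "is_orthonormal_polys M \<phi>" and "degree q < k"
  shows "L2_inner M q (\<phi> k) = 0"
  using \<open>degree q < k\<close>
proof (induction "degree q" arbitrary: q rule: less_induct)
  case less
  define d where "d = degree q"
  define c where "c = lead_coeff q / lead_coeff (\<phi> d)"
  have dd: "degree (\<phi> d) = d" and lc: "lead_coeff (\<phi> d) \<noteq> 0"
    using \<phi> unfolding is_orthonormal_polys_def by auto (metis less_irrefl zero_complex.sel(1))
  define r where "r = q - smult c (\<phi> d)"
  have q: "q = r + smult c (\<phi> d)" unfolding r_def by simp
  have "L2_inner M (\<phi> d) (\<phi> k) = 0"
    using \<phi> less.prems unfolding is_orthonormal_polys_def d_def by auto
  then have red: "L2_inner M q (\<phi> k) = L2_inner M r (\<phi> k)"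
    by (subst q) (simp add: L2_inner_add L2_inner_smult)
  have "degree r \<le> d" unfolding r_def d_def
    by (intro degree_diff_le) (use dd degree_smult_le[of c "\<phi> d"] d_def in auto)
  moreover have "coeff r d = 0"
    using lc dd unfolding r_def c_def d_def by simp
  ultimately have "r = 0 \<or> degree r < d"
    by (metis leading_coeff_0_iff le_neq_implies_less)
  then show ?case
    using red less.hyps[of r] less.prems by (auto simp: L2_inner_0 d_def)
qed

lemma orthonormal_polys_unique:
  assumes \<phi>: "is_orthonormal_polys M \<phi>" and \<psi>: "is_orthonormal_polys M \<psi>"
  shows "\<phi> = \<psi>"
proof
  fix k
  define a where "a = lead_coeff (\<phi> k) / lead_coeff (\<psi> k)"
  have deg: "degree (\<phi> k) = k" "degree (\<psi> k) = k"
    using \<phi> \<psi> unfolding is_orthonormal_polys_def by auto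
  obtain s t where st: "lead_coeff (\<phi> k) = of_real s" "lead_coeff (\<psi> k) = of_real t" "s > 0" "t > 0"
    using \<phi> \<psi> unfolding is_orthonormal_polys_def by (metis Reals_cases Re_complex_of_real)
  then have a: "a = of_real (s / t)" unfolding a_def by simp
  define d where "d = \<phi> k - smult a (\<psi> k)"
  have "degree d \<le> k" unfolding d_def
    by (intro degree_diff_le) (use deg degree_smult_le[of a "\<psi> k"] in auto)
  moreover have "coeff d k = 0"
    using st deg unfolding d_def a_def by simp
  ultimately have dk: "d = 0 \<or> degree d < k"
    by (metis leading_coeff_0_iff le_neq_implies_less)
  have "L2_inner M d (\<phi> k) = 0" "L2_inner M d (\<psi> k) = 0"
    using dk orthogonal_lower_degree[OF \<phi>] orthogonal_lower_degree[OF \<psi>]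
    by (auto simp: L2_inner_0)
  then have "L2_inner M (\<phi> k) d = 0" "L2_inner M (\<psi> k) d = 0"
    using L2_inner_commute by (metis complex_cnj_zero)+
  then have "L2_inner M d d = 0"
    by (subst (1) d_def) (simp add: L2_inner_diff L2_inner_smult)
  then have "d = 0"
    using L2_inner_pos[of d] L2_inner_self[of d] by force
  then have eq: "\<phi> k = smult a (\<psi> k)" unfolding d_def by simp
  have one: "L2_inner M (\<phi> k) (\<phi> k) = 1" "L2_inner M (\<psi> k) (\<psi> k) = 1"
    using \<phi> \<psi> unfolding is_orthonormal_polys_def by auto
  have "L2_inner M (\<phi> k) (\<phi> k) = a * L2_inner M (\<psi> k) (\<phi> k)"
    by (subst (1) eq) (simp add: L2_inner_smult)
  also have "L2_inner M (\<psi> k) (\<phi> k) = cnj (L2_inner M (\<phi> k) (\<psi> k))"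
    by (rule L2_inner_commute)
  also have "L2_inner M (\<phi> k) (\<psi> k) = a * L2_inner M (\<psi> k) (\<psi> k)"
    by (subst eq) (simp add: L2_inner_smult)
  finally have "a * cnj a = 1" using one by simp
  then have "complex_of_real ((s / t) * (s / t)) = 1"
    unfolding a by (simp only: complex_cnj_complex_of_real of_real_mult)
  then have "(s / t)\<^sup>2 = 1"
    by (simp only: of_real_eq_1_iff power2_eq_square)
  moreover have "s / t > 0" using st by simp
  ultimately have "s / t = 1" by (simp only: power2_eq_1_iff) linarith
  then show "\<phi> k = \<psi> k" using eq a by simp
qed

lemma gram_schmidt_step:
  fixes \<phi> :: "nat \<Rightarrow> complex poly"
  assumes \<phi>: "\<And>k. k < n \<Longrightarrow> degree (\<phi> k) = k"
    and nrm: "\<And>k. k < n \<Longrightarrow> L2_inner M (\<phi> k) (\<phi> k) = 1"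
    and ort: "\<And>j k. j < k \<Longrightarrow> k < n \<Longrightarrow> L2_inner M (\<phi> k) (\<phi> j) = 0"
  shows "\<exists>p. degree p = n \<and> lead_coeff p \<in> \<real> \<and> Re (lead_coeff p) > 0 \<and>
             L2_inner M p p = 1 \<and> (\<forall>k<n. L2_inner M p (\<phi> k) = 0)"
proof -
  define e where "e = (\<lambda>k. L2_inner M (monom 1 n) (\<phi> k))"
  define s where "s = (\<Sum>k<n. smult (e k) (\<phi> k))"
  define r where "r = monom 1 n - s"
  have cs: "coeff s i = 0" if "i \<ge> n" for i
  proof -
    have "coeff (\<phi> k) i = 0" if "k < n" for k
      using \<phi>[OF that] that \<open>i \<ge> n\<close> by (intro coeff_eq_0) auto
    then show ?thesis unfolding s_def by (simp add: coeff_sum)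
  qed
  have cr: "coeff r n = 1" unfolding r_def by (simp add: cs)
  have "degree r \<le> n" by (rule degree_le) (auto simp: r_def cs)
  with cr have dr: "degree r = n" by (metis le_antisym le_degree zero_neq_one)
  have ortr: "L2_inner M r (\<phi> k) = 0" if "k < n" for k
  proof -
    have "L2_inner M (\<phi> i) (\<phi> k) = (if i = k then 1 else 0)" if "i < n" for i
    proof (cases i k rule: linorder_cases)
      case less
      then have "L2_inner M (\<phi> k) (\<phi> i) = 0" using ort \<open>k < n\<close> by blast
      then show ?thesis using less L2_inner_commute[of "\<phi> i" "\<phi> k"] by simp
    qed (use nrm ort that in auto)
    then have "L2_inner M s (\<phi> k) = (\<Sum>i<n. e i * (if i = k then 1 else 0))"
      unfolding s_def by (simp add: L2_inner_sum L2_inner_smult)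
    also have "\<dots> = e k" using that by (simp add: if_distrib cong: if_cong)
    finally show ?thesis unfolding r_def L2_inner_diff e_def by simp
  qed
  define N where "N = (LINT z|M. (cmod (poly r z))\<^sup>2)"
  have "r \<noteq> 0" using cr by auto
  then have N: "N > 0" unfolding N_def by (rule L2_inner_pos)
  define c where "c = complex_of_real (1 / sqrt N)"
  define p where "p = smult c r"
  have c0: "c \<noteq> 0" using N unfolding c_def by simp
  have "L2_inner M p p = c * L2_inner M r p"
    unfolding p_def by (rule L2_inner_smult)
  also have "L2_inner M r p = cnj (c * L2_inner M r r)"
    by (subst L2_inner_commute) (simp add: p_def L2_inner_smult)
  finally have "L2_inner M p p = of_real (1 / sqrt N * (1 / sqrt N) * N)"
    using L2_inner_self[of r] unfolding N_def[symmetric] c_def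
    by (simp only: complex_cnj_mult complex_cnj_complex_of_real of_real_mult mult.assoc)
  also have "1 / sqrt N * (1 / sqrt N) * N = 1" using N by (simp add: field_simps)
  finally have "L2_inner M p p = 1" by (simp only: of_real_1)
  moreover have "degree p = n" unfolding p_def using c0 dr by simp
  moreover have "lead_coeff p = c" unfolding p_def using dr cr by simp
  moreover have "\<forall>k<n. L2_inner M p (\<phi> k) = 0"
    unfolding p_def using ortr by (simp add: L2_inner_smult)
  ultimately show ?thesis using N unfolding c_def
    by (metis Re_complex_of_real Reals_of_real real_sqrt_gt_0_iff zero_less_divide_1_iff)
qed

lemma ex1_orthonormal_polys: "\<exists>!\<phi>. is_orthonormal_polys M \<phi>"
proof -
  define P where "P = (\<lambda>(f::nat \<Rightarrow> complex poly) n p.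
    degree p = n \<and> lead_coeff p \<in> \<real> \<and> Re (lead_coeff p) > 0 \<and>
    L2_inner M p p = 1 \<and> (\<forall>k<n. L2_inner M p (f k) = 0))"
  have "\<exists>f. \<forall>n. P f n (f n)"
  proof (rule dependent_wf_choice[where R = less_than])
    show "P f x r = P g x r" if "\<And>z. (z, x) \<in> less_than \<Longrightarrow> f z = g z" for f g x r
      using that unfolding P_def by auto
    show "\<exists>r. P f x r" if "\<And>y. (y, x) \<in> less_than \<Longrightarrow> P f y (f y)" for x f
    proof -
      have "P f y (f y)" if "y < x" for y using that \<open>\<And>y. (y, x) \<in> less_than \<Longrightarrow> P f y (f y)\<close> by simp
      then show ?thesis unfolding P_def by (intro gram_schmidt_step) auto
    qed
  qed auto
  then obtain f where f: "\<And>n. P f n (f n)" by blast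
  have "L2_inner M (f j) (f k) = (if j = k then 1 else 0)" for j k
  proof (cases j k rule: linorder_cases)
    case less
    then have "L2_inner M (f k) (f j) = 0" using f[of k] unfolding P_def by blast
    then show ?thesis using less L2_inner_commute[of "f j" "f k"] by simp
  qed (use f[of j] in \<open>auto simp: P_def\<close>)
  then have "is_orthonormal_polys M f"
    using f unfolding is_orthonormal_polys_def P_def by blast
  then show ?thesis using orthonormal_polys_unique by blast
qed

lemma is_orthonormal_polys_orthonormal_poly: "is_orthonormal_polys M (orthonormal_poly M)"
  unfolding orthonormal_poly_def by (rule theI'[OF ex1_orthonormal_polys])

end

end

theory Submission
  imports Defs
begin

text \<open>
  If a combination of the \<open>Q\<^sub>j\<close> vanishes, comparing the coefficients of \<open>z\<^bsup>n+2m\<^esup>\<close> removes \<open>Q\<^sub>0\<close>,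
  evaluating at \<open>0\<close> then removes \<open>Q\<^sub>1\<close>, and dividing by \<open>z\<close> leaves the same problem for \<open>m - 1\<close>.

  For \<open>|w| = 1\<close>, suppose \<open>K = K\<^sub>k(\<cdot>, w)\<close> has degree below \<open>k\<close>, or \<open>K(0) = 0\<close>. Put \<open>q = K\<close> or
  \<open>q = K/z\<close>, respectively. By the reproducing property \<open>(z - w)q\<close> is orthogonal to \<open>K\<close>, that is, to
  \<open>q\<close> or to \<open>zq\<close>. As multiplication by \<open>z\<close> is an isometry of \<open>L\<^sup>2(\<mu>)\<close>, orthogonality to one of
  \<open>q\<close>, \<open>zq\<close> implies orthogonality to the other, so \<open>(z - w)q\<close> is orthogonal to itself.
\<close>

lemma lin_indep_familyI:
  fixes Q :: "nat \<Rightarrow> complex poly"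
  assumes fin: "finite J"
    and indep: "\<And>c j. (\<Sum>j\<in>J. smult (c j) (Q j)) = 0 \<Longrightarrow> j \<in> J \<Longrightarrow> c j = 0"
  shows "lin_indep_family Q J"
proof -
  interpret module "smult :: complex \<Rightarrow> complex poly \<Rightarrow> complex poly"
    by standard (auto simp: smult_add_right smult_add_left)
  have inj: "inj_on Q J"
  proof (rule inj_onI, rule ccontr)
    fix i j assume ij: "i \<in> J" "j \<in> J" "Q i = Q j" "i \<noteq> j"
    define c :: "nat \<Rightarrow> complex" where "c = (\<lambda>k. if k = i then 1 else if k = j then -1 else 0)"
    have "(\<Sum>k\<in>J. smult (c k) (Q k)) = (\<Sum>k\<in>{i, j}. smult (c k) (Q k))"
      by (rule sum.mono_neutral_right) (use fin ij in \<open>auto simp: c_def\<close>)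
    also have "\<dots> = 0" using ij by (simp add: c_def)
    finally have "c i = 0" using indep ij by blast
    then show False by (simp add: c_def)
  qed
  have "\<not> dependent (Q ` J)"
  proof
    assume "dependent (Q ` J)"
    then obtain u j where "j \<in> J" "u (Q j) \<noteq> 0" "(\<Sum>v\<in>Q ` J. smult (u v) v) = 0"
      using fin by (auto simp: dependent_finite)
    moreover from this have "(\<Sum>j\<in>J. smult (u (Q j)) (Q j)) = 0"
      by (simp add: sum.reindex[OF inj])
    ultimately show False using indep[of "\<lambda>j. u (Q j)" j] by blast
  qed
  with inj show ?thesis by (simp add: lin_indep_family_def)
qed

text \<open>Only the degree of \<open>K k\<close> and its value at \<open>0\<close> matter, so the
  family is abstract. The induction keeps \<open>n\<close> fixed: dropping the first two terms and
  one factor z turns index j + 2 for m + 1 into index j for m, with the same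
  \<open>K (n + 2*m - j)\<close>.\<close>

lemma shifted_combination_eq_0D:
  fixes K :: "nat \<Rightarrow> 'a::idom poly"
  assumes deg: "\<And>k. degree (K k) = k" and nz: "\<And>k. poly (K k) 0 \<noteq> 0"
  shows "(\<Sum>j\<le>2*m. smult (c j) (monom 1 (j div 2) * K (n + 2*m - j))) = 0 \<Longrightarrow>
    j \<le> 2*m \<Longrightarrow> c j = 0"
proof (induction m arbitrary: c j)
  case 0
  moreover have "K n \<noteq> 0" using nz[of n] by auto
  ultimately show ?case by (simp add: one_poly_def[symmetric] monom_0)
next
  case (Suc m)
  define S where "S = (\<Sum>j\<le>2*m. smult (c (Suc (Suc j))) (monom 1 (j div 2) * K (n + 2*m - j)))"
  have S: "monom 1 1 * S =
      (\<Sum>j\<le>2*m. smult (c (Suc (Suc j))) (monom 1 (Suc (j div 2)) * K (n + 2*m - j)))"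
    unfolding S_def sum_distrib_left
    by (rule sum.cong) (simp_all add: mult.assoc[symmetric] mult_monom)
  \<comment> \<open>The terms j = 0, 1 carry no power of z; each later one does, since (j + 2) div 2
    = Suc (j div 2).\<close>
  have eq: "smult (c 0) (K (n + 2*m + 2)) + smult (c 1) (K (n + 2*m + 1)) + monom 1 1 * S = 0"
    using Suc.prems(1) unfolding S
    by (simp add: sum.atMost_Suc_shift monom_0 one_poly_def[symmetric] algebra_simps
        del: sum.atMost_Suc)
  \<comment> \<open>Hence z S has degree at most n + 2m + 1, and only the term with
    \<open>c 0\<close> reaches z^(n + 2m + 2).\<close>
  have "degree S \<le> n + 2*m"
    unfolding S_def
  proof (rule degree_sum_le)
    fix i assume "i \<in> {..2*m}"
    have "degree (smult (c (Suc (Suc i))) (monom 1 (i div 2) * K (n + 2*m - i)))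
        \<le> degree (monom (1::'a) (i div 2) * K (n + 2*m - i))"
      by (rule degree_smult_le)
    also have "\<dots> \<le> i div 2 + (n + 2*m - i)"
      using degree_mult_le[of "monom (1::'a) (i div 2)" "K (n + 2*m - i)"]
      by (simp add: deg degree_monom_eq)
    also have "\<dots> \<le> n + 2*m" using \<open>i \<in> {..2*m}\<close> by auto
    finally show "degree (smult (c (Suc (Suc i))) (monom 1 (i div 2) * K (n + 2*m - i)))
      \<le> n + 2*m" .
  qed simp
  then have top: "coeff (monom 1 1 * S) (n + 2*m + 2) = 0"
    by (simp add: coeff_monom_mult coeff_eq_0)
  have "coeff (K (n + 2*m + 1)) (n + 2*m + 2) = 0"
    by (rule coeff_eq_0) (simp add: deg)
  then have "c 0 * coeff (K (n + 2*m + 2)) (n + 2*m + 2) = 0"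
    using arg_cong[OF eq, of "\<lambda>p. coeff p (n + 2*m + 2)"] top
    by (simp del: add_2_eq_Suc')
  moreover have "coeff (K (n + 2*m + 2)) (n + 2*m + 2) \<noteq> 0"
    using nz[of "n + 2*m + 2"] leading_coeff_neq_0[of "K (n + 2*m + 2)"] deg[of "n + 2*m + 2"]
    by (metis poly_0)
  ultimately have c0: "c 0 = 0" by simp
  have "c 1 * poly (K (n + 2*m + 1)) 0 = 0"
    using arg_cong[OF eq, of "\<lambda>p. poly p 0"] c0 by (simp add: poly_monom)
  with nz have c1: "c 1 = 0" by simp
  have "S = 0" using eq c0 c1 by simp
  then have "c (Suc (Suc i)) = 0" if "i \<le> 2*m" for i
    using Suc.IH[of "\<lambda>j. c (Suc (Suc j))" i] that unfolding S_def by blast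
  with c0 c1 show ?case
    using Suc.prems(2) by (cases j rule: old.nat.exhaust; cases "j - 1") auto
qed

context
  fixes \<mu> :: "complex measure"
  assumes \<mu>: "nontrivial_circle_measure \<mu>"
begin

lemmas orthonormal = is_orthonormal_polys_orthonormal_poly[OF \<mu>]

lemma degree_orthonormal_poly: "degree (orthonormal_poly \<mu> k) = k"
  using orthonormal by (simp add: is_orthonormal_polys_def)

lemma lead_coeff_orthonormal_poly: "coeff (orthonormal_poly \<mu> k) k \<noteq> 0"
  using orthonormal unfolding is_orthonormal_polys_def by (metis less_irrefl zero_complex.sel(1))

lemma L2_inner_orthonormal_poly:
  "L2_inner \<mu> (orthonormal_poly \<mu> j) (orthonormal_poly \<mu> k) = (if j = k then 1 else 0)"
  using orthonormal by (simp add: is_orthonormal_polys_def)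

lemma L2_inner_diff_right: "L2_inner \<mu> p (q - r) = L2_inner \<mu> p q - L2_inner \<mu> p r"
  by (subst (1 2 3) L2_inner_commute[OF \<mu>]) (simp add: L2_inner_diff[OF \<mu>])

lemma L2_inner_smult_right: "L2_inner \<mu> p (smult c q) = cnj c * L2_inner \<mu> p q"
  by (subst (1 2) L2_inner_commute[OF \<mu>]) (simp add: L2_inner_smult[OF \<mu>])

lemma L2_inner_sum_right: "L2_inner \<mu> p (sum f A) = (\<Sum>i\<in>A. L2_inner \<mu> p (f i))"
proof -
  have "L2_inner \<mu> p (sum f A) = cnj (L2_inner \<mu> (sum f A) p)"
    by (rule L2_inner_commute[OF \<mu>])
  also have "\<dots> = (\<Sum>i\<in>A. cnj (L2_inner \<mu> (f i) p))"
    by (simp add: L2_inner_sum[OF \<mu>])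
  finally show ?thesis by (simp only: L2_inner_commute[OF \<mu>, of p, symmetric])
qed

lemma L2_inner_self_eq_0D: "L2_inner \<mu> p p = 0 \<Longrightarrow> p = 0"
  using L2_inner_pos[OF \<mu>, of p] L2_inner_self[OF \<mu>, of p] by force

text \<open>The reproducing property: pairing with the kernel evaluates at w the orthonormal
  expansion of p. The conjugates in the kernel's coefficients cancel because the inner product is
  conjugate-linear in its second argument.\<close>

lemma L2_inner_CD_kernel:
  assumes "degree p \<le> n"
  shows "L2_inner \<mu> p (CD_kernel \<mu> n w) = poly p w"
proof -
  let ?\<phi> = "orthonormal_poly \<mu>"
  have "(\<Sum>k<n. poly (?\<phi> k) w * L2_inner \<mu> p (?\<phi> k)) = poly p w" if "degree p < n" for n
    using that
  proof (induction n arbitrary: p)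
    case (Suc n)
    define c where "c = coeff p n / coeff (?\<phi> n) n"
    define r where "r = p - smult c (?\<phi> n)"
    have p: "p = r + smult c (?\<phi> n)" by (simp add: r_def)
    have "degree r \<le> n" unfolding r_def
      using Suc.prems degree_smult_le[of c "?\<phi> n"] degree_orthonormal_poly[of n]
      by (intro degree_diff_le) auto
    moreover have "coeff r n = 0"
      using lead_coeff_orthonormal_poly[of n] by (simp add: r_def c_def)
    \<comment> \<open>The case r = 0 is separate because the zero polynomial has degree 0, which is
      not below n when n = 0.\<close>
    ultimately have r: "r = 0 \<or> degree r < n"
      by (metis leading_coeff_0_iff le_neq_implies_less)
    then have "(\<Sum>k<n. poly (?\<phi> k) w * L2_inner \<mu> r (?\<phi> k)) = poly r w"
      using Suc.IH by (auto simp: L2_inner_0[OF \<mu>])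
    moreover have "L2_inner \<mu> r (?\<phi> n) = 0"
      using r orthogonal_lower_degree[OF \<mu> orthonormal] by (auto simp: L2_inner_0[OF \<mu>])
    ultimately show ?case
      unfolding p by (simp add: L2_inner_add[OF \<mu>] L2_inner_smult[OF \<mu>]
          L2_inner_orthonormal_poly algebra_simps)
  qed simp
  from this[of "Suc n"] assms show ?thesis
    by (simp add: CD_kernel_def L2_inner_sum_right L2_inner_smult_right lessThan_Suc_atMost)
qed

lemma degree_CD_kernel_le: "degree (CD_kernel \<mu> k w) \<le> k"
  unfolding CD_kernel_def
  by (rule degree_sum_le) (auto intro: order.trans[OF degree_smult_le] simp: degree_orthonormal_poly)

text \<open>Pairing the constant 1 with the kernel gives 1 by the reproducing property; a zero
  kernel would give 0.\<close>

lemma CD_kernel_nonzero: "CD_kernel \<mu> k w \<noteq> 0"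
  using L2_inner_CD_kernel[of 1 k w] L2_inner_commute[OF \<mu>, of 1 0] L2_inner_0[OF \<mu>, of 1] by auto

lemma L2_inner_shift: "L2_inner \<mu> ([:0, 1:] * p) ([:0, 1:] * q) = L2_inner \<mu> p q"
  unfolding L2_inner_def
proof (rule Bochner_Integration.integral_cong)
  fix z assume "z \<in> space \<mu>"
  then have "z * cnj z = 1"
    by (simp add: space_circle[OF \<mu>] complex_norm_square[symmetric])
  then show "poly ([:0, 1:] * p) z * cnj (poly ([:0, 1:] * q) z) = poly p z * cnj (poly q z)"
    by (simp add: mult.left_commute mult.assoc[symmetric])
qed simp

text \<open>The first claim serves the degree of the kernel, the second its value at 0. Each pairing
  determines the other, and both vanishing would make (z - w)q orthogonal to itself.\<close>

lemma L2_inner_linear_factor_nonzero: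
  assumes w: "cmod w = 1" and q: "q \<noteq> 0"
  shows "L2_inner \<mu> ([:- w, 1:] * q) q \<noteq> 0"
    and "L2_inner \<mu> ([:- w, 1:] * q) ([:0, 1:] * q) \<noteq> 0"
proof -
  let ?p = "[:- w, 1:] * q" and ?zq = "[:0, 1:] * q"
  have p: "?p = ?zq - smult w q" by simp
  have ww: "w * cnj w = 1" using w by (simp add: complex_norm_square[symmetric])
  have a: "L2_inner \<mu> ?p ?zq = L2_inner \<mu> q q - w * L2_inner \<mu> q ?zq"
    unfolding p by (simp only: L2_inner_diff[OF \<mu>] L2_inner_smult[OF \<mu>] L2_inner_shift)
  have b: "cnj (L2_inner \<mu> ?p q) = L2_inner \<mu> q ?zq - cnj w * L2_inner \<mu> q q"
    unfolding L2_inner_commute[OF \<mu>, of q ?p, symmetric] unfolding p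
    by (simp only: L2_inner_diff_right L2_inner_smult_right)
  have "w * cnj (L2_inner \<mu> ?p q) = w * L2_inner \<mu> q ?zq - (w * cnj w) * L2_inner \<mu> q q"
    unfolding b by (simp add: right_diff_distrib mult.assoc)
  \<comment> \<open>Here |w| = 1 enters: multiplying the conjugated pairing by w turns its terms
    into those of \<open>a\<close> with opposite signs.\<close>
  with a ww have rel: "L2_inner \<mu> ?p ?zq = - w * cnj (L2_inner \<mu> ?p q)" by simp
  have self: "L2_inner \<mu> ?p ?p = L2_inner \<mu> ?p ?zq - cnj w * L2_inner \<mu> ?p q"
    by (subst (2) p) (simp only: L2_inner_diff_right L2_inner_smult_right)
  have "?p \<noteq> 0" using q by (metis mult_eq_0_iff pCons_eq_0_iff zero_neq_one)
  then have "L2_inner \<mu> ?p ?p \<noteq> 0" using L2_inner_self_eq_0D by blast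
  then show *: "L2_inner \<mu> ?p q \<noteq> 0" using rel unfolding self by auto
  have "w \<noteq> 0" using w by auto
  with * show "L2_inner \<mu> ?p ?zq \<noteq> 0" unfolding rel by simp
qed

lemma degree_linear_factor_mult:
  "q \<noteq> 0 \<Longrightarrow> degree ([:a, 1:] * q) = Suc (degree q)" for q :: "complex poly"
  by (subst degree_mult_eq) auto

lemma degree_CD_kernel:
  assumes w: "cmod w = 1"
  shows "degree (CD_kernel \<mu> k w) = k"
proof (rule ccontr)
  let ?K = "CD_kernel \<mu> k w"
  assume "degree ?K \<noteq> k"
  \<comment> \<open>A drop in degree leaves room for the factor z - w, so the reproducing property
    still applies and gives the value at w, which is 0.\<close>
  with degree_CD_kernel_le have "degree ([:- w, 1:] * ?K) \<le> k"
    by (simp only: degree_linear_factor_mult[OF CD_kernel_nonzero] Suc_le_eq order_less_le simp_thms)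
  then have "L2_inner \<mu> ([:- w, 1:] * ?K) ?K = 0"
    by (subst L2_inner_CD_kernel) simp_all
  then show False
    using L2_inner_linear_factor_nonzero(1)[OF w CD_kernel_nonzero] by blast
qed

lemma poly_CD_kernel_0_nonzero:
  assumes w: "cmod w = 1"
  shows "poly (CD_kernel \<mu> k w) 0 \<noteq> 0"
proof
  let ?K = "CD_kernel \<mu> k w"
  assume "poly ?K 0 = 0"
  then obtain q where K: "?K = [:0, 1:] * q"
    by (auto simp: poly_eq_0_iff_dvd elim: dvdE)
  with CD_kernel_nonzero have q: "q \<noteq> 0" by (metis mult_zero_right)
  \<comment> \<open>Exchanging the factor z of the kernel for z - w keeps the degree at most k,
    within reach of the reproducing property.\<close>
  have "degree ([:- w, 1:] * q) = degree ?K"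
    unfolding K by (simp only: degree_linear_factor_mult[OF q])
  with degree_CD_kernel_le have "L2_inner \<mu> ([:- w, 1:] * q) ?K = 0"
    by (subst L2_inner_CD_kernel) simp_all
  then show False
    using L2_inner_linear_factor_nonzero(2)[OF w q] unfolding K by blast
qed

end

theorem proposition1p4:
  fixes \<mu> :: "complex measure" and m :: nat
    and p :: "nat \<Rightarrow> complex poly"
    and Q :: "nat \<Rightarrow> complex \<Rightarrow> nat \<Rightarrow> complex poly"
  assumes \<mu>: "nontrivial_circle_measure \<mu>"
    and m: "m \<ge> 1"
    and p: "\<And>j. j \<le> 2 * m \<Longrightarrow> p j = monom 1 (j div 2)"
    and Q: "\<And>n w j. j \<le> 2 * m \<Longrightarrow> Q n w j = p j * CD_kernel \<mu> (n + 2 * m - j) w"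
  shows "(\<forall>w. (\<forall>k. poly (CD_kernel \<mu> k w) 0 \<noteq> 0 \<and> degree (CD_kernel \<mu> k w) = k) \<longrightarrow>
              (\<forall>n. lin_indep_family (Q n w) {0..2 * m})) \<and>
         (\<forall>w. cmod w = 1 \<longrightarrow> (\<forall>n. lin_indep_family (Q n w) {0..2 * m}))"
proof -
  have indep: "lin_indep_family (Q n w) {0..2 * m}"
    if K: "\<And>k. poly (CD_kernel \<mu> k w) 0 \<noteq> 0" "\<And>k. degree (CD_kernel \<mu> k w) = k" for w n
  proof (rule lin_indep_familyI)
    fix c j assume "(\<Sum>j\<in>{0..2*m}. smult (c j) (Q n w j)) = 0" and j: "j \<in> {0..2*m}"
    then have "(\<Sum>j\<le>2*m. smult (c j) (monom 1 (j div 2) * CD_kernel \<mu> (n + 2*m - j) w)) = 0"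
      by (simp add: Q p atLeast0AtMost)
    then show "c j = 0"
      using j by (intro shifted_combination_eq_0D[of "\<lambda>k. CD_kernel \<mu> k w"]) (auto simp: K)
  qed simp
  then show ?thesis
    using degree_CD_kernel[OF \<mu>] poly_CD_kernel_0_nonzero[OF \<mu>] by blast
qed

end
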